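(* Let $H$ be a self-adjoint square matrix over the $*$-algebra $\mathcal S=(Cl_{1,0,1}(\mathbb R),*_1)$ described in the context. If $(C,L,R)$ and $(C',L',R')$ are both spectra of $H$ (in the sense defined in the context), then $C=C'$, $L=L'$ and $R=R'$ as multisets.
   Context: The real associative unital algebra $Cl_{1,0,1}(\mathbb R)$ has elements written uniquely as $(a,b)+(a',b')\delta$ with $a,b,a',b'\in\mathbb R$, where $(a,b),(a',b')$ lie in $\mathbb R\oplus\mathbb R$ (componentwise operations, unit $1=(1,1)$), and multiplication is determined by $\delta^2=0$ and $\delta(a',b')=(b',a')\delta$. The involution is $((a,b)+(a',b')\delta)^{*_1}=(a,b)+(b',a')\delta$. A real number $a$ is identified with $(a,a)$; a dual number $a+b\varepsilon$ ($a,b\in\mathbb R$) is identified with the element $a+b\delta=(a,a)+(b,b)\delta$, and $\operatorname{nst}(a+b\varepsilon)=b$. For a matrix $M$ over a $*$-algebra, $(M^* )_{ij}=(M_{ji})^*$; $M$ is self-adjoint if $M^*=M$; a square matrix $U$ is unitary if $U^*=U^{-1}$; $M$ and $K$ are unitarily similar if $K=UMU^*$ for some unitary $U$. For real matrices $l,r$ of equal size, $(l,r)$ denotes the matrix over $\mathcal S$ with entries $(l_{ij},r_{ij})$. A spectrum of a self-adjoint matrix $H$ over $\mathcal S$ is a triple of finite multisets $(C,L,R)$ such that: $C$ consists of dual numbers and $L,R$ consist of real numbers; $\operatorname{nst}(x)>0$ for all $x\in C$; $|L|=|R|$; and $H$ is unitarily similar to $c\oplus(l,r)$, where $c,l,r$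 are diagonal matrices whose diagonal entries, listed with multiplicity, are the elements of $C$, $L$, $R$ respectively ($\oplus$ is the block-diagonal direct sum; blocks may be empty). *)

theory Defs
  imports
    Complex_Main
    "HOL-Library.Multiset"
    "Jordan_Normal_Form.Matrix"
begin

text \<open>The algebra \<open>Cl\<^sub>1\<^sub>,\<^sub>0\<^sub>,\<^sub>1(\<real>)\<close>: the element \<open>(a, b) + (a', b')\<delta>\<close> is
  represented as \<open>Cl a b a' b'\<close>.\<close>

datatype cl101 = Cl real real real real

instantiation cl101 :: real_algebra_1
begin

definition zero_cl101 :: cl101 where "0 = Cl 0 0 0 0"

definition one_cl101 :: cl101 where "1 = Cl 1 1 0 0"

fun plus_cl101 :: "cl101 \<Rightarrow> cl101 \<Rightarrow> cl101" where
  "Cl a b a' b' + Cl c d c' d' = Cl (a + c) (b + d) (a' + c') (b' + d')"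

fun uminus_cl101 :: "cl101 \<Rightarrow> cl101" where
  "- Cl a b a' b' = Cl (- a) (- b) (- a') (- b')"

fun minus_cl101 :: "cl101 \<Rightarrow> cl101 \<Rightarrow> cl101" where
  "Cl a b a' b' - Cl c d c' d' = Cl (a - c) (b - d) (a' - c') (b' - d')"

text \<open>Since \<open>\<delta>\<^sup>2 = 0\<close> and \<open>\<delta>(c, d) = (d, c)\<delta>\<close>, the \<open>\<delta>\<close>-part of a product is
  \<open>(a, b)(c', d')\<delta> + (a', b')(d, c)\<delta>\<close>.\<close>

fun times_cl101 :: "cl101 \<Rightarrow> cl101 \<Rightarrow> cl101" where
  "Cl a b a' b' * Cl c d c' d' =
     Cl (a * c) (b * d) (a * c' + a' * d) (b * d' + b' * c)"

fun scaleR_cl101 :: "real \<Rightarrow> cl101 \<Rightarrow> cl101" where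
  "scaleR t (Cl a b a' b') = Cl (t * a) (t * b) (t * a') (t * b')"

instance
proof
  fix x y z :: cl101 and s t :: real
  show "x + y + z = x + (y + z)" by (cases x; cases y; cases z) simp
  show "x + y = y + x" by (cases x; cases y) simp
  show "0 + x = x" by (cases x) (simp add: zero_cl101_def)
  show "- x + x = 0" by (cases x) (simp add: zero_cl101_def)
  show "x - y = x + - y" by (cases x; cases y) simp
  show "x * y * z = x * (y * z)" by (cases x; cases y; cases z) (simp add: algebra_simps)
  show "(x + y) * z = x * z + y * z" by (cases x; cases y; cases z) (simp add: algebra_simps)
  show "x * (y + z) = x * y + x * z" by (cases x; cases y; cases z) (simp add: algebra_simps)
  show "1 * x = x" by (cases x) (simp add: one_cl101_def)
  show "x * 1 = x" by (cases x) (simp add: one_cl101_def)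
  show "(0 :: cl101) \<noteq> 1" by (simp add: zero_cl101_def one_cl101_def)
  show "t *\<^sub>R (x + y) = t *\<^sub>R x + t *\<^sub>R y" by (cases x; cases y) (simp add: algebra_simps)
  show "(s + t) *\<^sub>R x = s *\<^sub>R x + t *\<^sub>R x" by (cases x) (simp add: algebra_simps)
  show "s *\<^sub>R t *\<^sub>R x = (s * t) *\<^sub>R x" by (cases x) simp
  show "1 *\<^sub>R x = x" by (cases x) simp
  show "(t *\<^sub>R x) * y = t *\<^sub>R (x * y)" by (cases x; cases y) (simp add: algebra_simps)
  show "x * (t *\<^sub>R y) = t *\<^sub>R (x * y)" by (cases x; cases y) (simp add: algebra_simps)
qed

end

definition cl_pair :: "real \<Rightarrow> real \<Rightarrow> cl101" where
  "cl_pair a b = Cl a b 0 0"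

definition cl_delta :: cl101 where
  "cl_delta = Cl 0 0 1 1"

fun cl_star :: "cl101 \<Rightarrow> cl101" where
  "cl_star (Cl a b a' b') = Cl a b b' a'"

lemma Cl_eq: "Cl a b a' b' = cl_pair a b + cl_pair a' b' * cl_delta"
  by (simp add: cl_pair_def cl_delta_def)

lemma cl_pair_times: "cl_pair a b * cl_pair c d = cl_pair (a * c) (b * d)"
  by (simp add: cl_pair_def)

lemma cl_delta_squared: "cl_delta * cl_delta = 0"
  by (simp add: cl_delta_def zero_cl101_def)

lemma cl_delta_times_pair: "cl_delta * cl_pair a b = cl_pair b a * cl_delta"
  by (simp add: cl_pair_def cl_delta_def)

lemma of_real_cl101: "of_real a = cl_pair a a"
  by (simp add: of_real_def one_cl101_def cl_pair_def)

lemma cl_star_star: "cl_star (cl_star x) = x"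
  by (cases x) simp

lemma cl_star_add: "cl_star (x + y) = cl_star x + cl_star y"
  by (cases x; cases y) simp

lemma cl_star_scaleR: "cl_star (t *\<^sub>R x) = t *\<^sub>R cl_star x"
  by (cases x) simp

lemma cl_star_times: "cl_star (x * y) = cl_star y * cl_star x"
  by (cases x; cases y) (simp add: algebra_simps)

text \<open>\<open>Dual a b\<close> is the dual number \<open>a + b\<epsilon>\<close>.\<close>

datatype dual_number = Dual (st: real) (nst: real)

definition cl_of_dual :: "dual_number \<Rightarrow> cl101" where
  "cl_of_dual x = of_real (st x) + of_real (nst x) * cl_delta"

text \<open>The conjugate transpose in Jordan_Normal_Form is restricted to conjugations that preserve
  the order of products, whereas \<open>cl_star\<close> reverses it.\<close>

definition cl_adjoint :: "cl101 mat \<Rightarrow> cl101 mat" where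
  "cl_adjoint M = map_mat cl_star (transpose_mat M)"

definition cl_self_adjoint :: "cl101 mat \<Rightarrow> bool" where
  "cl_self_adjoint M \<longleftrightarrow> cl_adjoint M = M"

definition cl_unitary :: "cl101 mat \<Rightarrow> bool" where
  "cl_unitary U \<longleftrightarrow> square_mat U \<and> inverts_mat U (cl_adjoint U) \<and> inverts_mat (cl_adjoint U) U"

text \<open>Products in Jordan_Normal_Form are defined for all dimensions, so the dimensions of \<open>M\<close>
  and \<open>U\<close> are constrained explicitly.\<close>

definition cl_unitarily_similar :: "cl101 mat \<Rightarrow> cl101 mat \<Rightarrow> bool" where
  "cl_unitarily_similar M K \<longleftrightarrow>
     (\<exists>n U. M \<in> carrier_mat n n \<and> U \<in> carrier_mat n n \<and> cl_unitary U \<and>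
            K = U * M * cl_adjoint U)"

text \<open>The matrix \<open>(l, r)\<close> for real matrices \<open>l\<close>, \<open>r\<close> of equal size.\<close>

definition cl_pair_mat :: "real mat \<Rightarrow> real mat \<Rightarrow> cl101 mat" where
  "cl_pair_mat l r =
     mat (dim_row l) (dim_col l) (\<lambda>(i, j). cl_pair (l $$ (i, j)) (r $$ (i, j)))"

definition is_spectrum ::
  "cl101 mat \<Rightarrow> dual_number multiset \<times> real multiset \<times> real multiset \<Rightarrow> bool" where
  "is_spectrum H = (\<lambda>(C, L, R).
     (\<forall>x \<in># C. nst x > 0) \<and> size L = size R \<and>
     (\<exists>c l r. square_mat c \<and> diagonal_mat c \<and> mset (diag_mat c) = image_mset cl_of_dual C \<and>
              square_mat l \<and> diagonal_mat l \<and> mset (diag_mat l) = L \<and>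
              square_mat r \<and> diagonal_mat r \<and> mset (diag_mat r) = R \<and>
              cl_unitarily_similar H (diag_block_mat [c, cl_pair_mat l r])))"

end

theory Submission
  imports Defs "Jordan_Normal_Form.Char_Poly"
begin

text \<open>
  Two spectra of \<open>H\<close> give diagonal self-adjoint matrices \<open>D\<close>, \<open>E\<close> and an invertible \<open>W\<close> with
  \<open>E W = W D\<close>. As \<open>D\<close> and \<open>E\<close> are diagonal, this relation splits into scalar relations
  \<open>e\<^sub>i w\<^sub>i\<^sub>j = w\<^sub>i\<^sub>j d\<^sub>j\<close>. The two semisimple components of \<open>\<S>\<close> are ring homomorphisms onto \<open>\<real>\<close>, so the
  multisets \<open>st(C) + L\<close> and \<open>st(C) + R\<close> are eigenvalue multisets of similar real matrices.
  For a real \<open>\<mu>\<close>, replace each diagonal entry \<open>(a, b) + (p, p)\<delta>\<close> by \<open>p\<^sup>2\<close> if \<open>a = b = \<mu>\<close> and by \<open>0\<close>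
  otherwise: the result is still intertwined by the first component of \<open>W\<close>, because on the
  \<open>\<mu>\<close>-eigenspaces the commutator terms produced by the \<open>\<delta>\<close>-part of \<open>W\<close> vanish. Its nonzero
  eigenvalues are the \<open>nst(x)\<^sup>2\<close> for \<open>x \<in> C\<close> with \<open>st(x) = \<mu>\<close>, which determines \<open>C\<close>.
\<close>

section \<open>Diagonal matrices with an invertible intertwiner\<close>

lemma proots_prod_linear_factors:
  fixes xs :: "'a::idom list"
  shows "proots (\<Prod>a\<leftarrow>xs. [:- a, 1:]) = mset xs"
proof (induction xs)
  case (Cons a xs)
  have "(\<Prod>a\<leftarrow>xs. [:- a, 1:]) \<noteq> 0"
    by (auto simp: prod_list_zero_iff)
  then show ?case
    using Cons by (simp add: proots_mult del: mult_pCons_left)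
qed simp

text \<open>A diagonal matrix is upper triangular, so its characteristic polynomial is the product
  of the linear factors of its diagonal. Similar matrices share it, and its roots with multiplicity
  return the diagonal.\<close>

lemma mset_diag_mat_similar:
  fixes A B :: "'a::idom mat"
  assumes "similar_mat A B" and "A \<in> carrier_mat n n" and "B \<in> carrier_mat n n"
    and "diagonal_mat A" and "diagonal_mat B"
  shows "mset (diag_mat A) = mset (diag_mat B)"
proof -
  have "upper_triangular A" "upper_triangular B"
    using assms(2-5) by (auto simp: diagonal_mat_def)
  then have "(\<Prod>a\<leftarrow>diag_mat A. [:- a, 1:]) = (\<Prod>a\<leftarrow>diag_mat B. [:- a, 1:])"
    using char_poly_similar[OF assms(1)] char_poly_upper_triangular assms(2,3) by metis
  then show ?thesis
    by (metis proots_prod_linear_factors)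
qed

lemma diagonal_mat_eq_mat_diag:
  assumes "A \<in> carrier_mat n n" and "diagonal_mat A"
  shows "A = mat_diag n (\<lambda>i. A $$ (i, i))"
  using assms by (auto simp: mat_diag_def diagonal_mat_def)

lemma diagonal_mat_diag: "diagonal_mat (mat_diag n f)"
  by (simp add: mat_diag_def diagonal_mat_def)

lemma diagonal_intertwining_entry:
  fixes D E W :: "'a::ring_1 mat"
  assumes "D \<in> carrier_mat n n" and "E \<in> carrier_mat n n" and "W \<in> carrier_mat n n"
    and "diagonal_mat D" and "diagonal_mat E" and "E * W = W * D"
    and "i < n" and "j < n"
  shows "E $$ (i, i) * W $$ (i, j) = W $$ (i, j) * D $$ (j, j)"
proof -
  have "mat_diag n (\<lambda>i. E $$ (i, i)) * W = W * mat_diag n (\<lambda>i. D $$ (i, i))"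
    using assms diagonal_mat_eq_mat_diag by metis
  then have "(mat_diag n (\<lambda>i. E $$ (i, i)) * W) $$ (i, j) = (W * mat_diag n (\<lambda>i. D $$ (i, i))) $$ (i, j)"
    by simp
  then show ?thesis
    using assms by (simp add: mat_diag_mult_left[of _ n n] mat_diag_mult_right[of _ n n])
qed

lemma mult_cancel_middle:
  fixes A B C D :: "'a::semiring_1 mat"
  assumes "A \<in> carrier_mat n n" and "B \<in> carrier_mat n n" and "C \<in> carrier_mat n n" and "D \<in> carrier_mat n n"
    and "B * C = 1\<^sub>m n"
  shows "(A * B) * (C * D) = A * D"
proof -
  have "(A * B) * (C * D) = A * (B * (C * D))"
    using assms by (intro assoc_mult_mat) auto
  also have "B * (C * D) = (B * C) * D"
    using assms by (intro assoc_mult_mat[symmetric]) auto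
  finally show ?thesis using assms by simp
qed

text \<open>The homomorphism \<open>\<phi>\<close> keeps \<open>W\<close> invertible, and the
  condition on \<open>g\<close> transfers each scalar relation, so the diagonals with
  \<open>g\<close> applied belong to similar matrices. Having \<open>g\<close> separate from
  \<open>\<phi>\<close> admits the nonlinear \<open>delta_weight \<mu>\<close>.\<close>

lemma image_mset_diag_intertwined:
  fixes D E W V :: "'a::ring_1 mat" and \<phi> g :: "'a \<Rightarrow> 'b::idom"
  assumes "semiring_hom \<phi>"
    and carrier: "D \<in> carrier_mat n n" "E \<in> carrier_mat n n" "W \<in> carrier_mat n n" "V \<in> carrier_mat n n"
    and "diagonal_mat D" and "diagonal_mat E" and "E * W = W * D"
    and "W * V = 1\<^sub>m n" and "V * W = 1\<^sub>m n"
    and g: "\<And>x y w. x \<in> set (diag_mat E) \<Longrightarrow> y \<in> set (diag_mat D) \<Longrightarrow> x * w = w * y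
              \<Longrightarrow> g x * \<phi> w = \<phi> w * g y"
  shows "image_mset g (mset (diag_mat E)) = image_mset g (mset (diag_mat D))"
proof -
  interpret semiring_hom \<phi> by fact
  define D' where "D' = mat_diag n (\<lambda>i. g (D $$ (i, i)))"
  define E' where "E' = mat_diag n (\<lambda>i. g (E $$ (i, i)))"
  define P where "P = map_mat \<phi> W"
  define Q where "Q = map_mat \<phi> V"
  have carrier': "D' \<in> carrier_mat n n" "E' \<in> carrier_mat n n" "P \<in> carrier_mat n n" "Q \<in> carrier_mat n n"
    using carrier by (auto simp: D'_def E'_def P_def Q_def)
  have PQ: "P * Q = 1\<^sub>m n" "Q * P = 1\<^sub>m n"
    unfolding P_def Q_def using carrier assms(9,10) by (metis mat_hom_mult mat_hom_one)+
  have "E' * P = P * D'"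
  proof (rule eq_matI)
    fix i j assume "i < dim_row (P * D')" "j < dim_col (P * D')"
    then have ij: "i < n" "j < n" using carrier' by auto
    have "g (E $$ (i, i)) * \<phi> (W $$ (i, j)) = \<phi> (W $$ (i, j)) * g (D $$ (j, j))"
      using ij carrier diagonal_intertwining_entry[OF carrier(1-3) assms(6-8) ij]
      by (intro g) (auto simp: diag_mat_def)
    then show "(E' * P) $$ (i, j) = (P * D') $$ (i, j)"
      using ij carrier carrier' unfolding E'_def D'_def
      by (simp add: mat_diag_mult_left[of _ n n] mat_diag_mult_right[of _ n n] P_def)
  qed (use carrier' in auto)
  then have "E' = P * D' * Q"
    using carrier' PQ by (metis assoc_mult_mat right_mult_one_mat)
  then have "similar_mat E' D'"
    unfolding similar_mat_def using similar_mat_witI PQ carrier' by metis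
  then have "mset (diag_mat E') = mset (diag_mat D')"
    using carrier' by (intro mset_diag_mat_similar[where n = n]) (auto simp: D'_def E'_def diagonal_mat_diag)
  moreover have "diag_mat D' = map g (diag_mat D)" "diag_mat E' = map g (diag_mat E)"
    using carrier by (auto simp: diag_mat_def D'_def E'_def mat_diag_def)
  ultimately show ?thesis by simp
qed

section \<open>Scalar invariants of the algebra\<close>

fun cl_left :: "cl101 \<Rightarrow> real" where
  "cl_left (Cl a b a' b') = a"

fun cl_right :: "cl101 \<Rightarrow> real" where
  "cl_right (Cl a b a' b') = b"

interpretation cl_left: semiring_hom cl_left
proof
  fix x y :: cl101
  show "cl_left (x + y) = cl_left x + cl_left y" "cl_left (x * y) = cl_left x * cl_left y"
    by (cases x; cases y; simp)+
qed (simp_all add: zero_cl101_def one_cl101_def)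

interpretation cl_right: semiring_hom cl_right
proof
  fix x y :: cl101
  show "cl_right (x + y) = cl_right x + cl_right y" "cl_right (x * y) = cl_right x * cl_right y"
    by (cases x; cases y; simp)+
qed (simp_all add: zero_cl101_def one_cl101_def)

text \<open>The square is forced: conjugation by the unitary \<open>cl_pair 1 (- 1)\<close> sends
  \<delta> to -\<delta>, so the sign of \<open>p\<close> is not invariant. The function is applied
  to elements fixed by the involution, where \<open>p = q\<close>.\<close>

fun delta_weight :: "real \<Rightarrow> cl101 \<Rightarrow> real" where
  "delta_weight \<mu> (Cl a b p q) = (if a = \<mu> \<and> b = \<mu> then p\<^sup>2 else 0)"

lemma cl_star_fixedE:
  assumes "cl_star x = x"
  obtains a b p where "x = Cl a b p p"
  using assms by (cases x) (metis cl101.inject cl_star.simps)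

lemma delta_weight_intertwined:
  assumes "cl_star x = x" and "cl_star y = y" and "x * w = w * y"
  shows "delta_weight \<mu> x * cl_left w = cl_left w * delta_weight \<mu> y"
proof -
  obtain a' b' p' where x: "x = Cl a' b' p' p'" using cl_star_fixedE[OF assms(1)] .
  obtain a b p where y: "y = Cl a b p p" using cl_star_fixedE[OF assms(2)] .
  obtain X Y Z T where w: "w = Cl X Y Z T" by (cases w)
  have rel: "a' * X = X * a" "b' * Y = Y * b"
    "a' * Z + p' * Y = X * p + Z * b" "b' * T + p' * X = Y * p + T * a"
    using assms(3) by (simp_all add: x y w)
  consider "X = 0" | "a' = a" "Y = 0" | "a' = a" "b' = b"
    using rel(1,2) by (metis mult.commute mult_right_cancel)
  then show ?thesis
  proof cases
    \<comment> \<open>With \<open>Y = 0\<close>, the equality \<open>a = b'\<close> cancels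
      \<open>T\<close> and leaves \<open>p' * X = 0\<close>; likewise \<open>a = b\<close> cancels
      \<open>Z\<close> and leaves \<open>X * p = 0\<close>.\<close>
    case 2
    then show ?thesis using rel by (auto simp: x y w)
  next
    case 3
    then show ?thesis
    proof (cases "a = \<mu> \<and> b = \<mu>")
      case True
      \<comment> \<open>All four semisimple coefficients equal \<open>\<mu>\<close>, so
        \<open>Z\<close> and \<open>T\<close> cancel. The remaining relations exchange
        \<open>X\<close> and \<open>Y\<close>; using both returns to \<open>X\<close> and produces
        the squares.\<close>
      with 3 rel have "p' * Y = X * p" "p' * X = Y * p" by auto
      then have "p' * (p' * X) = X * p * p" by (metis mult.assoc)
      with 3 True show ?thesis by (simp add: x y w power2_eq_square mult_ac)
    qed (auto simp: x y w)
  qed (simp add: w)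
qed

section \<open>Diagonals that come from spectra\<close>

lemma cl_of_dual_eq: "cl_of_dual x = Cl (st x) (st x) (nst x) (nst x)"
  by (simp add: cl_of_dual_def of_real_cl101 cl_pair_def cl_delta_def)

text \<open>The lists \<open>ls\<close> and \<open>rs\<close> are exposed because the diagonal of
  the pair matrix matches their entries by position, which \<open>L\<close> and \<open>R\<close> do
  not record.\<close>

lemma is_spectrumE:
  assumes "is_spectrum H (C, L, R)"
  obtains n U D ls rs where
    "H \<in> carrier_mat n n" "U \<in> carrier_mat n n" "cl_unitary U"
    "D \<in> carrier_mat n n" "D = U * H * cl_adjoint U" "diagonal_mat D"
    "mset ls = L" "mset rs = R" "length ls = length rs"
    "mset (diag_mat D) = image_mset cl_of_dual C + mset (map2 cl_pair ls rs)"
    "\<And>x. x \<in># C \<Longrightarrow> nst x > 0"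
proof -
  obtain c l r where
    c: "square_mat c" "diagonal_mat c" "mset (diag_mat c) = image_mset cl_of_dual C" and
    l: "square_mat l" "diagonal_mat l" "mset (diag_mat l) = L" and
    r: "square_mat r" "diagonal_mat r" "mset (diag_mat r) = R" and
    sim: "cl_unitarily_similar H (diag_block_mat [c, cl_pair_mat l r])" and
    pos: "\<And>x. x \<in># C \<Longrightarrow> nst x > 0" and size: "size L = size R"
    using assms by (auto simp: is_spectrum_def)
  define D where "D = diag_block_mat [c, cl_pair_mat l r]"
  obtain n U where U: "H \<in> carrier_mat n n" "U \<in> carrier_mat n n" "cl_unitary U"
      "D = U * H * cl_adjoint U"
    using sim unfolding cl_unitarily_similar_def D_def by blast
  \<comment> \<open>\<open>cl_pair_mat\<close> takes its dimensions from \<open>l\<close>; equal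
    cardinalities ensure that \<open>r\<close> has the same size.\<close>
  have dim: "dim_row l = dim_row r"
    using size l(3) r(3) by (auto simp: diag_mat_def)
  have sq: "dim_col c = dim_row c" "dim_col l = dim_row l" "dim_col r = dim_row r"
    using c l r by auto
  have "diagonal_mat (cl_pair_mat l r)"
    using l(2) r(2) dim sq by (auto simp: diagonal_mat_def cl_pair_mat_def cl_pair_def zero_cl101_def)
  then have "diagonal_mat D"
    using c(2) sq unfolding D_def diagonal_mat_def
    by (auto simp: Let_def cl_pair_mat_def)
  moreover have "D \<in> carrier_mat n n"
    using U by (auto simp: cl_adjoint_def)
  moreover have "diag_mat D = diag_mat c @ diag_mat (cl_pair_mat l r)"
    unfolding D_def diag_block_mat.simps(2)[of c] diag_block_mat_singleton Let_def
    by (rule diag_four_block_mat) (use sq in \<open>auto simp: cl_pair_mat_def\<close>)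
  moreover have "diag_mat (cl_pair_mat l r) = map2 cl_pair (diag_mat l) (diag_mat r)"
    using dim sq by (auto simp: diag_mat_def cl_pair_mat_def intro!: nth_equalityI)
  moreover have "length (diag_mat l) = length (diag_mat r)"
    using dim by (simp add: diag_mat_def)
  ultimately show thesis
    using that[of n U D "diag_mat l" "diag_mat r"] U l(3) r(3) c(3) pos by simp
qed

lemma image_cl_left_spectrum:
  assumes "length ls = length rs"
  shows "image_mset cl_left (image_mset cl_of_dual C + mset (map2 cl_pair ls rs)) = image_mset st C + mset ls"
proof -
  have "map cl_left (map2 cl_pair ls rs) = ls"
    using assms by (induction ls rs rule: list_induct2) (auto simp: cl_pair_def)
  moreover have "cl_left \<circ> cl_of_dual = st" by (auto simp: cl_of_dual_eq)
  ultimately show ?thesis by (simp flip: mset_map add: multiset.map_comp)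
qed

lemma image_cl_right_spectrum:
  assumes "length ls = length rs"
  shows "image_mset cl_right (image_mset cl_of_dual C + mset (map2 cl_pair ls rs)) = image_mset st C + mset rs"
proof -
  have "map cl_right (map2 cl_pair ls rs) = rs"
    using assms by (induction ls rs rule: list_induct2) (auto simp: cl_pair_def)
  moreover have "cl_right \<circ> cl_of_dual = st" by (auto simp: cl_of_dual_eq)
  ultimately show ?thesis by (simp flip: mset_map add: multiset.map_comp)
qed

text \<open>Pairs have no \<delta>-part and contribute only weight 0, while squaring is injective on
  the positive values of \<open>nst\<close>.\<close>

lemma count_delta_weight_spectrum:
  assumes "\<And>x. x \<in># C \<Longrightarrow> nst x > 0" and "v > 0"
  shows "count (image_mset (delta_weight \<mu>) (image_mset cl_of_dual C + mset (map2 cl_pair ls rs))) (v\<^sup>2)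
    = count C (Dual \<mu> v)"
proof -
  have "v\<^sup>2 \<notin> set (map (delta_weight \<mu>) (map2 cl_pair ls rs))"
    using assms(2) by (auto simp: cl_pair_def split: if_splits)
  then have "count (image_mset (delta_weight \<mu>) (mset (map2 cl_pair ls rs))) (v\<^sup>2) = 0"
    by (metis count_mset_0_iff mset_map)
  moreover have "count (image_mset (delta_weight \<mu>) (image_mset cl_of_dual C)) (v\<^sup>2) = count C (Dual \<mu> v)"
    using assms(1)
  proof (induction C)
    case (add x C)
    have "delta_weight \<mu> (cl_of_dual x) = v\<^sup>2 \<longleftrightarrow> x = Dual \<mu> v"
      using add.prems[of x] assms(2) by (cases x) (auto simp: cl_of_dual_eq power2_eq_iff)
    with add show ?case by auto
  qed simp
  ultimately show ?thesis by simp
qed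

section \<open>Comparison of two spectra of one matrix\<close>

theorem theorem7p2:
  fixes H :: "cl101 mat"
    and C C' :: "dual_number multiset"
    and L R L' R' :: "real multiset"
  assumes "square_mat H"
    and "cl_self_adjoint H"
    and "is_spectrum H (C, L, R)"
    and "is_spectrum H (C', L', R')"
  shows "C = C' \<and> L = L' \<and> R = R'"
proof -
  obtain n U D ls rs where
    H: "H \<in> carrier_mat n n" and U: "U \<in> carrier_mat n n" "cl_unitary U" and
    D: "D \<in> carrier_mat n n" "D = U * H * cl_adjoint U" "diagonal_mat D" and
    LR: "mset ls = L" "mset rs = R" "length ls = length rs" and
    diag: "mset (diag_mat D) = image_mset cl_of_dual C + mset (map2 cl_pair ls rs)" and
    pos: "\<And>x. x \<in># C \<Longrightarrow> nst x > 0"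
    by (rule is_spectrumE[OF assms(3)]) blast
  obtain m V E ls' rs' where
    H': "H \<in> carrier_mat m m" and V: "V \<in> carrier_mat m m" "cl_unitary V" and
    E: "E \<in> carrier_mat m m" "E = V * H * cl_adjoint V" "diagonal_mat E" and
    LR': "mset ls' = L'" "mset rs' = R'" "length ls' = length rs'" and
    diag': "mset (diag_mat E) = image_mset cl_of_dual C' + mset (map2 cl_pair ls' rs')" and
    pos': "\<And>x. x \<in># C' \<Longrightarrow> nst x > 0"
    by (rule is_spectrumE[OF assms(4)]) blast
  have mn: "m = n" using H H' by auto
  have Vn: "V \<in> carrier_mat n n" and En: "E \<in> carrier_mat n n"
    using V(1) E(1) unfolding mn .
  let ?U' = "cl_adjoint U" and ?V' = "cl_adjoint V"
  have U': "?U' \<in> carrier_mat n n" "U * ?U' = 1\<^sub>m n" "?U' * U = 1\<^sub>m n"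
    using U(2) carrier_matD[OF U(1)] by (auto simp: cl_unitary_def inverts_mat_def cl_adjoint_def)
  have V': "?V' \<in> carrier_mat n n" "V * ?V' = 1\<^sub>m n" "?V' * V = 1\<^sub>m n"
    using V(2) carrier_matD[OF Vn] by (auto simp: cl_unitary_def inverts_mat_def cl_adjoint_def)
  \<comment> \<open>\<open>W\<close> undoes the passage from \<open>H\<close> to \<open>D\<close>
    and then performs the one to \<open>E\<close>.\<close>
  define W where "W = V * ?U'"
  define W' where "W' = U * ?V'"
  have W: "W \<in> carrier_mat n n" "W' \<in> carrier_mat n n"
    unfolding W_def W'_def using U'(1) V'(1) U(1) Vn by (auto intro: mult_carrier_mat)
  have inv: "W * W' = 1\<^sub>m n" "W' * W = 1\<^sub>m n"
    using mult_cancel_middle[OF Vn U'(1) U(1) V'(1) U'(3)] mult_cancel_middle[OF U(1) V'(1) Vn U'(1) V'(3)]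
    by (simp_all add: W_def W'_def U'(2) V'(2))
  have inter: "E * W = W * D"
  proof -
    have "E * W = (V * H) * ?U'"
      unfolding W_def E(2) using H U'(1) Vn V' by (intro mult_cancel_middle[where n = n]) auto
    also have "\<dots> = V * (H * ?U')"
      using H U'(1) Vn by (intro assoc_mult_mat) auto
    \<comment> \<open>The identity \<open>?U' * U\<close> is inserted between \<open>V\<close> and
      \<open>H\<close>.\<close>
    also have "\<dots> = W * (U * (H * ?U'))"
      unfolding W_def using H U(1) U' Vn by (intro mult_cancel_middle[where n = n, symmetric]) auto
    also have "U * (H * ?U') = D"
      unfolding D(2) using H U(1) U'(1) by (intro assoc_mult_mat[symmetric]) auto
    finally show ?thesis .
  qed
  \<comment> \<open>Dual numbers and pairs have equal \<delta>-coefficients, which the swap in the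
    involution preserves.\<close>
  have sa: "cl_star x = x" if "x \<in> set (diag_mat D) \<union> set (diag_mat E)" for x
  proof -
    have "x \<in># mset (diag_mat D) + mset (diag_mat E)" using that by auto
    then show ?thesis
      unfolding diag diag' by (auto simp: cl_of_dual_eq cl_pair_def)
  qed
  note invariant = image_mset_diag_intertwined[OF _ D(1) En W D(3) E(3) inter inv]
  have left: "image_mset cl_left (mset (diag_mat E)) = image_mset cl_left (mset (diag_mat D))"
    by (rule invariant[OF cl_left.semiring_hom_axioms]) (metis cl_left.hom_mult)
  have right: "image_mset cl_right (mset (diag_mat E)) = image_mset cl_right (mset (diag_mat D))"
    by (rule invariant[OF cl_right.semiring_hom_axioms]) (metis cl_right.hom_mult)
  have weight: "image_mset (delta_weight \<mu>) (mset (diag_mat E)) = image_mset (delta_weight \<mu>) (mset (diag_mat D))" for \<mu>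
    by (rule invariant[OF cl_left.semiring_hom_axioms]) (use sa delta_weight_intertwined in blast)
  have "C = C'"
  proof (rule multiset_eqI)
    fix x
    obtain \<mu> v where x: "x = Dual \<mu> v" by (cases x)
    show "count C x = count C' x"
    proof (cases "v > 0")
      case True
      then show ?thesis
        using weight[of \<mu>] unfolding diag diag' x
        by (metis count_delta_weight_spectrum pos pos')
    next
      case False
      then have "x \<notin># C" "x \<notin># C'" using pos[of x] pos'[of x] x by auto
      then show ?thesis by (simp add: not_in_iff)
    qed
  qed
  \<comment> \<open>Once \<open>C = C'\<close> is known, the common summand
    \<open>image_mset st C\<close> cancels on both sides.\<close>
  moreover have "image_mset st C' + L' = image_mset st C + L"
    using left unfolding diag diag' image_cl_left_spectrum[OF LR(3)] image_cl_left_spectrum[OF LR'(3)] LR LR' .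
  moreover have "image_mset st C' + R' = image_mset st C + R"
    using right unfolding diag diag' image_cl_right_spectrum[OF LR(3)] image_cl_right_spectrum[OF LR'(3)] LR LR' .
  ultimately show ?thesis by simp
qed

end
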